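(* Let $n>1$ be an integer and let $\mathcal{C}$ denote any one of the three closed cones $\mathbb{R}^n$, $\mathcal{L}$, or $\partial(\mathcal{L})$, where $\mathcal{L}\subset\mathbb{R}^n$ is the second order cone. Then $$\mathcal{Z}(\mathcal{L})=\mathbb{R}\,\mathrm{I}-J(\mathcal{E}_{\mathcal{C}}+\mathcal{A}^n),$$ that is, $\mathcal{Z}(\mathcal{L})=\{\gamma\,\mathrm{I}-J(P+Q):\gamma\in\mathbb{R},\ P\in\mathcal{E}_{\mathcal{C}},\ Q\in\mathcal{A}^n\}$.
   Context: $\mathbb{R}^n$ (column vectors) carries the usual inner product $\langle\cdot,\cdot\rangle$ and norm $\|\cdot\|$. The second order cone is $\mathcal{L}=\{(t,u)^\top : t\in\mathbb{R},\ u\in\mathbb{R}^{n-1},\ t\ge\|u\|\}$; it is self-dual, i.e. $\mathcal{L}^*:=\{x\in\mathbb{R}^n:\langle x,y\rangle\ge 0\ \forall y\in\mathcal{L}\}=\mathcal{L}$. Its boundary is $\partial(\mathcal{L})=\{(t,u)^\top: t=\|u\|\}$. A matrix $A\in\mathbb{R}^{n\times n}$ is a $\mathcal{Z}$-transformation on $\mathcal{L}$ if $\langle Ax,y\rangle\le 0$ whenever $x\in\mathcal{L}$, $y\in\mathcal{L}^*=\mathcal{L}$ and $\langle x,y\rangle=0$. $\mathcal{Z}(\mathcal{L})\subseteq\mathbb{R}^{n\times n}$ denotes the set of all $\mathcal{Z}$-transformations on $\mathcal{L}$. $\mathrm{I}$ is the $n\times n$ identity matrix and $J=\operatorname{diag}(1,-1,-1,\ldots,-1)\in\mathbb{R}^{n\times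 n}$. $\mathcal{S}^n$ is the space of real symmetric $n\times n$ matrices and $\mathcal{A}^n$ is the space of real skew-symmetric $n\times n$ matrices. For a closed cone $\mathcal{C}\subseteq\mathbb{R}^n$ (not necessarily convex), the copositive cone of $\mathcal{C}$ is $\mathcal{E}_{\mathcal{C}}=\{A\in\mathcal{S}^n: x^\top Ax\ge 0\ \forall x\in\mathcal{C}\}$. (In particular $\mathcal{E}_{\mathbb{R}^n}=\mathcal{S}^n_+$, the cone of positive semidefinite symmetric matrices.) *)

theory Defs
  imports "HOL-Analysis.Analysis"
begin

text \<open>
  The coordinates of \<open>\<real>\<^sup>n\<close>, \<open>n = CARD('n)\<close>, are indexed by a finite linearly ordered type, so that
  \<open>x = (t, u)\<close> splits into the first coordinate \<open>t\<close> (the one with least index) and the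
  remaining \<open>n - 1\<close> coordinates \<open>u\<close>; \<open>tail_norm x\<close> is the Euclidean norm \<open>\<parallel>u\<parallel>\<close>.
\<close>

definition first_index :: "'n::{finite,linorder}" where
  "first_index = Min UNIV"

definition head_coord :: "real^'n::{finite,linorder} \<Rightarrow> real" where
  "head_coord x = x $ first_index"

definition tail_norm :: "real^'n::{finite,linorder} \<Rightarrow> real" where
  "tail_norm x = L2_set (\<lambda>i. x $ i) (UNIV - {first_index})"

definition second_order_cone :: "(real^'n::{finite,linorder}) set" where
  "second_order_cone = {x. tail_norm x \<le> head_coord x}"

definition dual_cone :: "(real^'n) set \<Rightarrow> (real^'n) set" where
  "dual_cone K = {x. \<forall>y\<in>K. 0 \<le> x \<bullet> y}"

definition Z_transformations :: "(real^'n) set \<Rightarrow> (real^'n^'n) set" where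
  "Z_transformations K =
     {A. \<forall>x\<in>K. \<forall>y\<in>dual_cone K. x \<bullet> y = 0 \<longrightarrow> (A *v x) \<bullet> y \<le> 0}"

definition J_mat :: "real^('n::{finite,linorder})^'n::{finite,linorder}" where
  "J_mat = (\<chi> i j. if i = j then (if i = first_index then 1 else - 1) else 0)"

definition symmetric_matrices :: "(real^'n^'n) set" where
  "symmetric_matrices = {A. transpose A = A}"

definition skew_symmetric_matrices :: "(real^'n^'n) set" where
  "skew_symmetric_matrices = {A. transpose A = - A}"

definition copositive_cone :: "(real^'n) set \<Rightarrow> (real^'n^'n) set" where
  "copositive_cone C = {A \<in> symmetric_matrices. \<forall>x\<in>C. 0 \<le> x \<bullet> (A *v x)}"

text \<open>
  The boundary \<open>\<partial>L\<close> is rendered as the library's \<open>frontier\<close>; the lemma below identifies it with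
  the explicit description \<open>{(t, u). t = \<parallel>u\<parallel>}\<close>.
\<close>

lemma continuous_on_tail_norm: "continuous_on UNIV (tail_norm :: real^'n::{finite,linorder} \<Rightarrow> real)"
  unfolding tail_norm_def L2_set_def by (intro continuous_intros)

lemma continuous_on_head_coord: "continuous_on UNIV (head_coord :: real^'n::{finite,linorder} \<Rightarrow> real)"
  unfolding head_coord_def by (intro continuous_intros)

lemma frontier_second_order_cone:
  "frontier (second_order_cone :: (real^'n::{finite,linorder}) set) =
     {x. head_coord x = tail_norm x}"
proof -
  let ?L = "second_order_cone :: (real, 'n) vec set"
  let ?e = "axis first_index 1 :: (real, 'n) vec"
  have cl: "closed ?L"
    unfolding second_order_cone_def
    by (intro closed_Collect_le continuous_on_tail_norm continuous_on_head_coord)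
  have op: "open {x::(real, 'n) vec. tail_norm x < head_coord x}"
    by (intro open_Collect_less continuous_on_tail_norm continuous_on_head_coord)
  have sub: "{x::(real, 'n) vec. tail_norm x < head_coord x} \<subseteq> interior ?L"
    by (rule interior_maximal[OF _ op]) (auto simp: second_order_cone_def)
  have strict: "tail_norm x < head_coord x" if x: "x \<in> interior ?L" for x
  proof -
    obtain d where d: "d > 0" "cball x d \<subseteq> ?L"
      using x by (meson mem_interior_cball)
    have "x - d *\<^sub>R ?e \<in> cball x d"
      using d by (simp add: dist_norm)
    hence "x - d *\<^sub>R ?e \<in> ?L"
      using d(2) by (rule rev_subsetD)
    hence "tail_norm (x - d *\<^sub>R ?e) \<le> head_coord (x - d *\<^sub>R ?e)"
      by (simp only: second_order_cone_def mem_Collect_eq)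
    moreover have "tail_norm (x - d *\<^sub>R ?e) = tail_norm x"
      unfolding tail_norm_def by (rule L2_set_cong) (auto simp: axis_def)
    moreover have "head_coord (x - d *\<^sub>R ?e) = head_coord x - d"
      by (simp add: head_coord_def axis_def)
    ultimately show ?thesis using d by simp
  qed
  have "interior ?L = {x. tail_norm x < head_coord x}"
    using sub strict by blast
  thus ?thesis
    using cl by (auto simp: frontier_def second_order_cone_def)
qed

end

theory Submission
  imports Defs
begin

text \<open>
  Write \<open>q(x) = x \<bullet> J x\<close> for the Lorentz form. Two orthogonal nonzero vectors of the second order
  cone \<open>L\<close> are necessarily of the form \<open>x\<close>, \<open>c J x\<close> with \<open>c > 0\<close> and \<open>x\<close> on the boundary
  (\<open>second_order_cone_complementary\<close>), so \<open>A\<close> is a \<open>Z\<close>-transformation exactly when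
  \<open>x \<bullet> J A x \<le> 0\<close> for all \<open>x \<in> \<partial>L\<close>.

  If \<open>A = \<gamma> I - J (P + Q)\<close> and \<open>x \<in> \<partial>L\<close>, then \<open>x \<bullet> J A x = \<gamma> q(x) - x \<bullet> P x - x \<bullet> Q x\<close>; here the
  first term vanishes on \<open>\<partial>L\<close> and the last one by skew-symmetry, so that copositivity of \<open>P\<close> on
  \<open>\<partial>L\<close>, the smallest of the three cones, gives the sign.

  Conversely, let \<open>S\<close> and \<open>Q\<close> be the symmetric and skew-symmetric parts of \<open>- J A\<close>. The form of
  \<open>S\<close> is nonnegative on \<open>\<partial>L\<close>, hence by homogeneity on the whole null set \<open>q = 0\<close>. Finsler's lemma
  (\<open>finsler_lemma\<close>) then yields \<open>\<gamma>\<close> such that \<open>P = S + \<gamma> J\<close> is positive semidefinite. This \<open>P\<close>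
  is copositive for each of the three cones at once, and \<open>J J = I\<close> turns \<open>- J A = P - \<gamma> J + Q\<close> into
  \<open>A = \<gamma> I - J (P + Q)\<close>.
\<close>

section \<open>The reflection \<open>J\<close>\<close>

text \<open>
  \<open>J\<close> fixes the first axis and negates its orthogonal complement. This form makes it possible to
  compute with inner products and first coordinates alone, without splitting sums over indices.
\<close>

lemma J_mat_mult_vec:
  fixes x :: "real^'n::{finite,linorder}"
  shows "J_mat *v x = (2 * head_coord x) *\<^sub>R axis first_index 1 - x"
  unfolding vec_eq_iff
proof
  fix i :: 'n
  have "(J_mat *v x) $ i = (\<Sum>j\<in>UNIV. if i = j then (if i = first_index then x $ j else - x $ j) else 0)"
    unfolding matrix_vector_mult_def J_mat_def vec_lambda_beta by (intro sum.cong) auto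
  also have "\<dots> = (if i = first_index then x $ i else - x $ i)"
    by simp
  also have "\<dots> = ((2 * head_coord x) *\<^sub>R axis first_index 1 - x) $ i"
    by (simp add: head_coord_def axis_def)
  finally show "(J_mat *v x) $ i = ((2 * head_coord x) *\<^sub>R axis first_index 1 - x) $ i" .
qed

lemma inner_axis_first_index:
  fixes x :: "real^'n::{finite,linorder}"
  shows "x \<bullet> axis first_index 1 = head_coord x" "axis first_index 1 \<bullet> x = head_coord x"
  by (simp_all add: head_coord_def inner_axis inner_axis')

lemma head_coord_arith [simp]:
  fixes x y :: "real^'n::{finite,linorder}"
  shows "head_coord (x + y) = head_coord x + head_coord y"
    and "head_coord (x - y) = head_coord x - head_coord y"
    and "head_coord (- x) = - head_coord x"
    and "head_coord (c *\<^sub>R x) = c * head_coord x"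
    and "head_coord (axis first_index 1 :: (real, 'n) vec) = 1"
  by (simp_all add: head_coord_def axis_def)

lemma head_coord_J_mat [simp]:
  fixes x :: "real^'n::{finite,linorder}"
  shows "head_coord (J_mat *v x) = head_coord x"
  by (simp add: J_mat_mult_vec)

lemma inner_J_mat:
  fixes x y :: "real^'n::{finite,linorder}"
  shows "x \<bullet> (J_mat *v y) = 2 * head_coord x * head_coord y - x \<bullet> y"
  by (simp add: J_mat_mult_vec inner_diff_right inner_axis_first_index)

lemma J_mat_mult_J_mat_mult:
  fixes x :: "real^'n::{finite,linorder}"
  shows "J_mat *v (J_mat *v x) = x"
  by (simp add: J_mat_mult_vec)

lemma J_mat_self_adjoint:
  fixes x y :: "real^'n::{finite,linorder}"
  shows "(J_mat *v x) \<bullet> y = x \<bullet> (J_mat *v y)"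
  by (simp add: inner_J_mat inner_commute [of _ y])

lemma inner_J_mat_J_mat:
  fixes x y :: "real^'n::{finite,linorder}"
  shows "(J_mat *v x) \<bullet> (J_mat *v y) = x \<bullet> y"
  by (simp add: J_mat_self_adjoint J_mat_mult_J_mat_mult)

lemma transpose_J_mat: "transpose J_mat = (J_mat :: real^('n::{finite,linorder})^'n::{finite,linorder})"
  by (auto simp: transpose_def J_mat_def vec_eq_iff)

section \<open>Orthogonal pairs in the second order cone\<close>

lemma inner_self_head_tail:
  fixes x :: "real^'n::{finite,linorder}"
  shows "x \<bullet> x = (head_coord x)\<^sup>2 + (tail_norm x)\<^sup>2"
proof -
  have "x \<bullet> x = (\<Sum>i\<in>UNIV. (x $ i)\<^sup>2)"
    by (simp add: inner_vec_def power2_eq_square)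
  also have "\<dots> = (x $ first_index)\<^sup>2 + (\<Sum>i\<in>UNIV - {first_index}. (x $ i)\<^sup>2)"
    by (rule sum.remove) auto
  finally show ?thesis
    by (simp add: head_coord_def tail_norm_def L2_set_def sum_nonneg)
qed

lemma tail_norm_nonneg: "0 \<le> tail_norm x"
  by (simp add: tail_norm_def)

lemma mem_second_order_cone_iff:
  fixes x :: "real^'n::{finite,linorder}"
  shows "x \<in> second_order_cone \<longleftrightarrow> 0 \<le> head_coord x \<and> x \<bullet> x \<le> 2 * (head_coord x)\<^sup>2"
proof -
  have "tail_norm x \<le> head_coord x \<longleftrightarrow> 0 \<le> head_coord x \<and> (tail_norm x)\<^sup>2 \<le> (head_coord x)\<^sup>2"
    using tail_norm_nonneg [of x] by (meson order_trans power2_le_imp_le power_mono)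
  then show ?thesis
    by (auto simp: second_order_cone_def inner_self_head_tail)
qed

lemma mem_frontier_second_order_cone_iff:
  fixes x :: "real^'n::{finite,linorder}"
  shows "x \<in> frontier second_order_cone \<longleftrightarrow> 0 \<le> head_coord x \<and> x \<bullet> (J_mat *v x) = 0"
proof -
  have "head_coord x = tail_norm x \<longleftrightarrow> 0 \<le> head_coord x \<and> (head_coord x)\<^sup>2 = (tail_norm x)\<^sup>2"
    using tail_norm_nonneg [of x] by (auto intro: power2_eq_imp_eq)
  then show ?thesis
    by (auto simp: frontier_second_order_cone inner_J_mat inner_self_head_tail power2_eq_square)
qed

lemma J_mat_mem_second_order_cone:
  fixes x :: "real^'n::{finite,linorder}"
  assumes "x \<in> second_order_cone"
  shows "J_mat *v x \<in> second_order_cone"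
  using assms by (simp add: mem_second_order_cone_iff inner_J_mat_J_mat)

lemma second_order_cone_eq_0:
  fixes x :: "real^'n::{finite,linorder}"
  assumes "x \<in> second_order_cone" "head_coord x = 0"
  shows "x = 0"
  using assms by (auto simp: mem_second_order_cone_iff simp flip: power2_norm_eq_inner)

lemma frontier_second_order_cone_subset:
  "frontier second_order_cone \<subseteq> (second_order_cone :: (real^'n::{finite,linorder}) set)"
  unfolding frontier_second_order_cone by (auto simp: second_order_cone_def)

text \<open>
  A quantitative Cauchy-Schwarz inequality on the cone: its left-hand side being nonnegative puts the
  cone inside its dual, and its right-hand side being zero gives the shape of orthogonal pairs.
\<close>

lemma second_order_cone_inner_bound:
  fixes x y :: "real^'n::{finite,linorder}"
  assumes "x \<in> second_order_cone" "y \<in> second_order_cone"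
  shows "(norm (head_coord x *\<^sub>R y - head_coord y *\<^sub>R (J_mat *v x)))\<^sup>2
    \<le> 2 * (head_coord x * head_coord y) * (x \<bullet> y)"
proof -
  let ?a = "head_coord x" and ?b = "head_coord y"
  have "(norm (?a *\<^sub>R y - ?b *\<^sub>R (J_mat *v x)))\<^sup>2
      = ?a\<^sup>2 * (y \<bullet> y) + ?b\<^sup>2 * (x \<bullet> x) - 2 * (?a * ?b) * (y \<bullet> (J_mat *v x))"
    unfolding power2_norm_eq_inner
    by (simp add: inner_diff_left inner_diff_right inner_J_mat_J_mat
        inner_commute [of "J_mat *v x" y] power2_eq_square algebra_simps)
  also have "\<dots> \<le> ?a\<^sup>2 * (2 * ?b\<^sup>2) + ?b\<^sup>2 * (2 * ?a\<^sup>2) - 2 * (?a * ?b) * (y \<bullet> (J_mat *v x))"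
    using assms unfolding mem_second_order_cone_iff
    by (intro diff_right_mono add_mono mult_left_mono) auto
  also have "\<dots> = 2 * (?a * ?b) * (x \<bullet> y)"
    by (simp add: inner_J_mat inner_commute [of y x] power2_eq_square algebra_simps)
  finally show ?thesis .
qed

lemma dual_cone_second_order_cone:
  "dual_cone second_order_cone = (second_order_cone :: (real^'n::{finite,linorder}) set)"
proof (intro equalityI subsetI)
  fix y :: "(real, 'n) vec"
  assume "y \<in> dual_cone second_order_cone"
  then have dual: "0 \<le> y \<bullet> x" if "x \<in> second_order_cone" for x
    using that by (auto simp: dual_cone_def)
  let ?e = "axis first_index 1 :: (real, 'n) vec"
  have ee: "?e \<bullet> ?e = 1"
    by (simp add: inner_axis_first_index)
  \<comment> \<open>Among cone vectors with a given first coordinate, the inner product with \<open>y\<close> is smallest at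
    the boundary vector whose tail is a negative multiple of that of \<open>y\<close>.\<close>
  define x where "x = (tail_norm y + head_coord y) *\<^sub>R ?e - y"
  have hx: "head_coord x = tail_norm y"
    by (simp add: x_def)
  have "x \<bullet> x = 2 * (tail_norm y)\<^sup>2"
    by (simp add: x_def inner_diff_left inner_diff_right inner_axis_first_index
        inner_self_head_tail [of y] power2_eq_square algebra_simps)
  then have "x \<in> second_order_cone"
    by (simp add: mem_second_order_cone_iff hx tail_norm_nonneg)
  then have "0 \<le> y \<bullet> x"
    by (rule dual)
  also have "y \<bullet> x = tail_norm y * (head_coord y - tail_norm y)"
    by (simp add: x_def inner_diff_right inner_axis_first_index
        inner_self_head_tail [of y] power2_eq_square algebra_simps)
  finally have prod: "0 \<le> tail_norm y * (head_coord y - tail_norm y)" .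
  have "?e \<in> second_order_cone"
    by (simp add: mem_second_order_cone_iff ee)
  then have "0 \<le> head_coord y"
    using dual [of ?e] by (simp add: inner_axis_first_index)
  then show "y \<in> second_order_cone"
    using prod tail_norm_nonneg [of y]
    by (auto simp: second_order_cone_def zero_le_mult_iff)
next
  fix y :: "(real, 'n) vec"
  assume y: "y \<in> second_order_cone"
  have "0 \<le> y \<bullet> x" if x: "x \<in> second_order_cone" for x
  proof (cases "head_coord x = 0 \<or> head_coord y = 0")
    case True
    then show ?thesis
      using second_order_cone_eq_0 x y by fastforce
  next
    case False
    then have "0 < 2 * (head_coord y * head_coord x)"
      using x y by (simp add: mem_second_order_cone_iff)
    moreover have "0 \<le> 2 * (head_coord y * head_coord x) * (y \<bullet> x)"
      by (rule order_trans [OF zero_le_power2 second_order_cone_inner_bound [OF y x]])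
    ultimately show ?thesis
      by (metis zero_le_mult_iff not_less)
  qed
  then show "y \<in> dual_cone second_order_cone"
    by (simp add: dual_cone_def)
qed

lemma second_order_cone_complementary:
  fixes x y :: "real^'n::{finite,linorder}"
  assumes x: "x \<in> second_order_cone" and y: "y \<in> second_order_cone"
    and orth: "x \<bullet> y = 0" and "x \<noteq> 0" "y \<noteq> 0"
  obtains c where "0 < c" "y = c *\<^sub>R (J_mat *v x)" "x \<in> frontier second_order_cone"
proof -
  have pos: "0 < head_coord x" "0 < head_coord y"
    using assms second_order_cone_eq_0
    by (auto simp: mem_second_order_cone_iff order_less_le)
  have "(norm (head_coord x *\<^sub>R y - head_coord y *\<^sub>R (J_mat *v x)))\<^sup>2 \<le> 0"
    using second_order_cone_inner_bound [OF x y] orth by simp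
  then have eq: "head_coord x *\<^sub>R y = head_coord y *\<^sub>R (J_mat *v x)"
    by simp
  define c where "c = head_coord y / head_coord x"
  have c: "0 < c"
    using pos by (simp add: c_def)
  have "y = (1 / head_coord x) *\<^sub>R (head_coord x *\<^sub>R y)"
    using pos by simp
  also have "\<dots> = c *\<^sub>R (J_mat *v x)"
    by (simp add: eq c_def)
  finally have yc: "y = c *\<^sub>R (J_mat *v x)" .
  then have "x \<bullet> (J_mat *v x) = 0"
    using orth c by simp
  with pos have "x \<in> frontier second_order_cone"
    by (simp add: mem_frontier_second_order_cone_iff)
  with c yc show thesis
    by (rule that)
qed

text \<open>
  By self-duality and complementarity, the defining condition has to be tested only on the pairs
  \<open>(x, J x)\<close> with \<open>x\<close> on the boundary.
\<close>

lemma mem_Z_transformations_second_order_cone_iff: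
  fixes A :: "real^('n::{finite,linorder})^'n::{finite,linorder}"
  shows "A \<in> Z_transformations second_order_cone \<longleftrightarrow>
    (\<forall>x\<in>frontier second_order_cone. (A *v x) \<bullet> (J_mat *v x) \<le> 0)"
    (is "_ \<longleftrightarrow> ?R")
proof
  assume A: "A \<in> Z_transformations second_order_cone"
  show ?R
  proof
    fix x :: "(real, 'n) vec"
    assume x: "x \<in> frontier second_order_cone"
    then have "x \<in> second_order_cone"
      using frontier_second_order_cone_subset by blast
    with A x J_mat_mem_second_order_cone [of x] show "(A *v x) \<bullet> (J_mat *v x) \<le> 0"
      by (simp add: Z_transformations_def dual_cone_second_order_cone
          mem_frontier_second_order_cone_iff)
  qed
next
  assume R: ?R
  have "(A *v x) \<bullet> y \<le> 0"
    if x: "x \<in> second_order_cone" and y: "y \<in> second_order_cone" and orth: "x \<bullet> y = 0" for x y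
  proof (cases "x = 0 \<or> y = 0")
    case True
    then show ?thesis
      by auto
  next
    case False
    then obtain c where "0 < c" "y = c *\<^sub>R (J_mat *v x)" "x \<in> frontier second_order_cone"
      using second_order_cone_complementary [OF x y orth] by blast
    with R show ?thesis
      by (simp add: mult_nonneg_nonpos)
  qed
  then show "A \<in> Z_transformations second_order_cone"
    by (simp add: Z_transformations_def dual_cone_second_order_cone)
qed

section \<open>Finsler's lemma\<close>

lemma quadratic_form_combination:
  fixes A :: "real^'n^'n"
  shows "(a *\<^sub>R u + v) \<bullet> (A *v (a *\<^sub>R u + v)) =
    a\<^sup>2 * (u \<bullet> (A *v u)) + a * (u \<bullet> (A *v v) + v \<bullet> (A *v u)) + v \<bullet> (A *v v)"
  by (simp add: matrix_vector_right_distrib matrix_vector_mult_scaleR inner_add_left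
      inner_add_right power2_eq_square algebra_simps)

lemma quadratic_roots_of_opposite_sign:
  fixes p b r :: real
  assumes "0 < p" "r < 0"
  obtains \<alpha> \<beta> where "\<alpha> < 0" "0 < \<beta>" "\<alpha> * \<beta> = r / p"
    "p * \<alpha>\<^sup>2 + b * \<alpha> + r = 0" "p * \<beta>\<^sup>2 + b * \<beta> + r = 0"
proof -
  define D where "D = b\<^sup>2 - 4 * p * r"
  define d where "d = sqrt D"
  have "b\<^sup>2 < D"
    using assms by (simp add: D_def mult_pos_neg)
  then have "\<bar>b\<bar> < d"
    unfolding d_def by (metis real_sqrt_abs real_sqrt_less_iff)
  then have bd: "b < d" "- d < b"
    by auto
  have "0 \<le> D"
    using \<open>b\<^sup>2 < D\<close> by (smt (verit) zero_le_power2)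
  then have d2: "d * d = b * b - 4 * p * r"
    by (simp add: d_def D_def power2_eq_square)
  show thesis
  proof (rule that [of "(- b - d) / (2 * p)" "(- b + d) / (2 * p)"])
    show "(- b - d) / (2 * p) < 0" "0 < (- b + d) / (2 * p)"
      using assms bd by (auto simp: divide_less_0_iff)
    show "(- b - d) / (2 * p) * ((- b + d) / (2 * p)) = r / p"
    proof -
      have "(- b - d) / (2 * p) * ((- b + d) / (2 * p)) = (b * b - d * d) / (4 * p * p)"
        by (simp add: algebra_simps)
      also have "\<dots> = (4 * p * r) / (4 * p * p)"
        by (simp add: d2)
      also have "\<dots> = r / p"
        using assms by simp
      finally show ?thesis .
    qed
    have root: "p * x\<^sup>2 + b * x + r = 0" if "2 * p * x + b = s" "s * s = d * d" for x s :: real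
    proof -
      have "4 * p * (p * x\<^sup>2 + b * x + r) = (2 * p * x + b) * (2 * p * x + b) - (b * b - 4 * p * r)"
        by (simp add: power2_eq_square algebra_simps)
      also have "\<dots> = 0"
        using that d2 by simp
      finally show ?thesis
        using assms by simp
    qed
    show "p * ((- b - d) / (2 * p))\<^sup>2 + b * ((- b - d) / (2 * p)) + r = 0"
      by (rule root [of _ "- d"]) (use assms in \<open>auto simp: field_simps\<close>)
    show "p * ((- b + d) / (2 * p))\<^sup>2 + b * ((- b + d) / (2 * p)) + r = 0"
      by (rule root [of _ d]) (use assms in \<open>auto simp: field_simps\<close>)
  qed
qed

text \<open>
  The plane spanned by \<open>u\<close> and \<open>v\<close> contains two null vectors \<open>\<alpha> u + v\<close> and \<open>\<beta> u + v\<close> of \<open>M\<close>, with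
  \<open>\<alpha> < 0 < \<beta>\<close>. Adding the nonnegative values of \<open>S\<close> at them with weights \<open>\<beta>\<close> and \<open>- \<alpha>\<close> cancels the
  mixed terms in \<open>u\<close> and \<open>v\<close>.
\<close>

lemma finsler_two_point_inequality:
  fixes S M :: "real^'n^'n"
  assumes null: "\<And>x. x \<bullet> (M *v x) = 0 \<Longrightarrow> 0 \<le> x \<bullet> (S *v x)"
    and u: "0 < u \<bullet> (M *v u)" and v: "v \<bullet> (M *v v) < 0"
  shows "- (u \<bullet> (S *v u)) / (u \<bullet> (M *v u)) \<le> - (v \<bullet> (S *v v)) / (v \<bullet> (M *v v))"
proof -
  define p r s t m where "p = u \<bullet> (M *v u)" and "r = v \<bullet> (M *v v)"
    and "s = u \<bullet> (S *v u)" and "t = v \<bullet> (S *v v)"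
    and "m = u \<bullet> (S *v v) + v \<bullet> (S *v u)"
  have p: "0 < p" and r: "r < 0"
    using u v by (simp_all add: p_def r_def)
  obtain \<alpha> \<beta> where ab: "\<alpha> < 0" "0 < \<beta>" "\<alpha> * \<beta> = r / p"
    and roots: "p * \<alpha>\<^sup>2 + (u \<bullet> (M *v v) + v \<bullet> (M *v u)) * \<alpha> + r = 0"
      "p * \<beta>\<^sup>2 + (u \<bullet> (M *v v) + v \<bullet> (M *v u)) * \<beta> + r = 0"
    using quadratic_roots_of_opposite_sign [OF p r] .
  have "(\<alpha> *\<^sub>R u + v) \<bullet> (M *v (\<alpha> *\<^sub>R u + v)) = 0" "(\<beta> *\<^sub>R u + v) \<bullet> (M *v (\<beta> *\<^sub>R u + v)) = 0"
    using roots unfolding quadratic_form_combination by (simp_all add: p_def r_def mult.commute)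
  from this [THEN null]
  have S: "0 \<le> \<alpha>\<^sup>2 * s + \<alpha> * m + t" "0 \<le> \<beta>\<^sup>2 * s + \<beta> * m + t"
    unfolding quadratic_form_combination by (simp_all add: s_def t_def m_def)
  have "0 \<le> \<beta> * (\<alpha>\<^sup>2 * s + \<alpha> * m + t) + (- \<alpha>) * (\<beta>\<^sup>2 * s + \<beta> * m + t)"
    by (rule add_nonneg_nonneg; rule mult_nonneg_nonneg) (use S ab in auto)
  also have "\<dots> = (\<beta> - \<alpha>) * (t - (\<alpha> * \<beta>) * s)"
    by (simp add: power2_eq_square algebra_simps)
  finally have "0 \<le> t - (r / p) * s"
    using ab by (simp add: zero_le_mult_iff)
  then show ?thesis
    using p r unfolding p_def [symmetric] r_def [symmetric] s_def [symmetric] t_def [symmetric]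
    by (simp add: field_simps)
qed

text \<open>
  A multiplier \<open>\<gamma>\<close> works precisely if it lies above every quotient \<open>- S(u) / M(u)\<close> with \<open>M(u) > 0\<close>
  and below every such quotient with \<open>M(u) < 0\<close>; the two-point inequality says that the former all
  lie below the latter, and so the supremum of the former is a valid choice. Indefiniteness makes
  this supremum exist.
\<close>

lemma finsler_lemma:
  fixes S M :: "real^'n^'n"
  assumes null: "\<And>x. x \<bullet> (M *v x) = 0 \<Longrightarrow> 0 \<le> x \<bullet> (S *v x)"
    and u: "0 < u \<bullet> (M *v u)" and v: "v \<bullet> (M *v v) < 0"
  obtains \<gamma> where "\<And>x. 0 \<le> x \<bullet> ((S + \<gamma> *\<^sub>R M) *v x)"
proof -
  define U where "U = (\<lambda>x. - (x \<bullet> (S *v x)) / (x \<bullet> (M *v x))) ` {x. 0 < x \<bullet> (M *v x)}"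
  define \<gamma> where "\<gamma> = Sup U"
  have below: "z \<le> - (y \<bullet> (S *v y)) / (y \<bullet> (M *v y))" if "z \<in> U" "y \<bullet> (M *v y) < 0" for y z
    using that finsler_two_point_inequality [OF null] by (auto simp: U_def)
  have "U \<noteq> {}"
    using u by (auto simp: U_def)
  have "bdd_above U"
    using below v by (meson bdd_aboveI)
  have "0 \<le> x \<bullet> ((S + \<gamma> *\<^sub>R M) *v x)" for x
  proof -
    have expand: "x \<bullet> ((S + \<gamma> *\<^sub>R M) *v x) = x \<bullet> (S *v x) + \<gamma> * (x \<bullet> (M *v x))"
      by (simp add: matrix_vector_mult_add_rdistrib inner_add_right scaleR_matrix_vector_assoc [symmetric])
    consider "x \<bullet> (M *v x) = 0" | "0 < x \<bullet> (M *v x)" | "x \<bullet> (M *v x) < 0"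
      by linarith
    then show ?thesis
    proof cases
      case 1
      then show ?thesis
        using null [of x] by (simp add: expand)
    next
      case 2
      then have "- (x \<bullet> (S *v x)) / (x \<bullet> (M *v x)) \<le> \<gamma>"
        unfolding \<gamma>_def using \<open>bdd_above U\<close> by (intro cSup_upper) (auto simp: U_def)
      with 2 show ?thesis
        by (simp add: expand field_simps)
    next
      case 3
      then have "\<gamma> \<le> - (x \<bullet> (S *v x)) / (x \<bullet> (M *v x))"
        unfolding \<gamma>_def using \<open>U \<noteq> {}\<close> below by (intro cSup_least) auto
      with 3 show ?thesis
        by (simp add: expand field_simps)
    qed
  qed
  then show thesis
    by (rule that)
qed

section \<open>The representation of Z-transformations\<close>

lemma minus_matrix_vector_mult:
  fixes A :: "real^'n^'n"
  shows "(- A) *v x = - (A *v x)"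
  by (simp add: matrix_vector_mult_def vec_eq_iff sum_negf)

lemma quadratic_form_transpose:
  fixes A :: "real^'n^'n"
  shows "x \<bullet> (transpose A *v x) = x \<bullet> (A *v x)"
proof -
  have "x \<bullet> (transpose A *v x) = (x v* A) \<bullet> x"
    by (simp add: inner_commute)
  also have "\<dots> = x \<bullet> (A *v x)"
    by (rule dot_lmul_matrix)
  finally show ?thesis .
qed

lemma skew_symmetric_quadratic_form:
  assumes "Q \<in> skew_symmetric_matrices"
  shows "x \<bullet> (Q *v x) = 0"
proof -
  have "x \<bullet> (Q *v x) = x \<bullet> (transpose Q *v x)"
    by (rule quadratic_form_transpose [symmetric])
  also have "\<dots> = - (x \<bullet> (Q *v x))"
    using assms
    by (simp add: skew_symmetric_matrices_def minus_matrix_vector_mult del: transpose_matrix_vector)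
  finally show ?thesis
    by simp
qed

lemma copositive_cone_antimono: "C \<subseteq> D \<Longrightarrow> copositive_cone D \<subseteq> copositive_cone C"
  by (auto simp: copositive_cone_def)

lemma copositive_imp_Z_transformation:
  fixes P Q :: "real^('n::{finite,linorder})^'n::{finite,linorder}"
  assumes P: "P \<in> copositive_cone (frontier second_order_cone)"
    and Q: "Q \<in> skew_symmetric_matrices"
  shows "\<gamma> *\<^sub>R mat 1 - J_mat ** (P + Q) \<in> Z_transformations second_order_cone"
  unfolding mem_Z_transformations_second_order_cone_iff
proof
  fix x :: "(real, 'n) vec"
  assume x: "x \<in> frontier second_order_cone"
  have "((\<gamma> *\<^sub>R mat 1 - J_mat ** (P + Q)) *v x) \<bullet> (J_mat *v x)
      = \<gamma> * (x \<bullet> (J_mat *v x)) - (J_mat *v ((P + Q) *v x)) \<bullet> (J_mat *v x)"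
    by (simp add: matrix_vector_mult_diff_rdistrib inner_diff_left
        scaleR_matrix_vector_assoc [symmetric] matrix_vector_mul_assoc [symmetric])
  also have "\<dots> = - (x \<bullet> (P *v x))"
    using x skew_symmetric_quadratic_form [OF Q, of x]
    by (simp add: mem_frontier_second_order_cone_iff inner_J_mat_J_mat
        inner_commute [of _ x] matrix_vector_mult_add_rdistrib inner_add_right)
  also have "\<dots> \<le> 0"
    using P x by (simp add: copositive_cone_def)
  finally show "((\<gamma> *\<^sub>R mat 1 - J_mat ** (P + Q)) *v x) \<bullet> (J_mat *v x) \<le> 0" .
qed

lemma J_mat_indefinite:
  assumes "CARD('n::{finite,linorder}) > 1"
  obtains u v :: "real^'n::{finite,linorder}" where "0 < u \<bullet> (J_mat *v u)" "v \<bullet> (J_mat *v v) < 0"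
proof -
  have "(UNIV :: 'n set) \<noteq> {first_index}"
  proof
    assume eq: "(UNIV :: 'n set) = {first_index}"
    have "CARD('n) = 1"
      unfolding eq by simp
    with assms show False
      by simp
  qed
  then obtain k :: 'n where k: "k \<noteq> first_index"
    by blast
  show thesis
  proof
    show "0 < (axis first_index 1 :: (real, 'n) vec) \<bullet> (J_mat *v axis first_index 1)"
      by (simp add: inner_J_mat inner_axis_axis)
    show "(axis k 1 :: (real, 'n) vec) \<bullet> (J_mat *v axis k 1) < 0"
    proof -
      have "head_coord (axis k 1 :: (real, 'n) vec) = 0"
        using k by (simp add: head_coord_def axis_def)
      then show ?thesis
        by (simp add: inner_J_mat inner_axis_axis)
    qed
  qed
qed

text \<open>
  Splitting \<open>- J A\<close> into symmetric and skew parts, only the symmetric part is seen by the boundary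
  condition; Finsler's lemma shifts it by a multiple of \<open>J\<close> to a form that is nonnegative everywhere,
  and the shift reappears as the multiple of the identity in \<open>A\<close>.
\<close>

lemma Z_transformation_imp_semidefinite:
  fixes A :: "real^('n::{finite,linorder})^'n::{finite,linorder}"
  assumes n: "CARD('n) > 1"
    and A: "A \<in> Z_transformations second_order_cone"
  obtains \<gamma> P Q where "P \<in> copositive_cone UNIV" "Q \<in> skew_symmetric_matrices"
    "A = \<gamma> *\<^sub>R mat 1 - J_mat ** (P + Q)"
proof -
  define B where "B = - (J_mat ** A)"
  define S where "S = (1/2) *\<^sub>R (B + transpose B)"
  define Q where "Q = (1/2) *\<^sub>R (B - transpose B)"
  have S_sym: "transpose S = S" and Q: "Q \<in> skew_symmetric_matrices" and SQ: "S + Q = B"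
    by (simp_all add: S_def Q_def skew_symmetric_matrices_def transpose_def vec_eq_iff field_simps)
  have S_form: "x \<bullet> (S *v x) = - ((A *v x) \<bullet> (J_mat *v x))" for x
  proof -
    have "x \<bullet> (S *v x) = x \<bullet> (B *v x)"
      by (simp add: S_def scaleR_matrix_vector_assoc [symmetric] matrix_vector_mult_add_rdistrib
          inner_add_right quadratic_form_transpose del: transpose_matrix_vector)
    also have "\<dots> = - (x \<bullet> (J_mat *v (A *v x)))"
      by (simp add: B_def minus_matrix_vector_mult matrix_vector_mul_assoc)
    also have "x \<bullet> (J_mat *v (A *v x)) = (A *v x) \<bullet> (J_mat *v x)"
      by (metis J_mat_self_adjoint inner_commute)
    finally show ?thesis .
  qed
  have null: "0 \<le> x \<bullet> (S *v x)" if x: "x \<bullet> (J_mat *v x) = 0" for x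
  proof -
    have front: "0 \<le> y \<bullet> (S *v y)" if "y \<in> frontier second_order_cone" for y
      using A that by (simp add: S_form mem_Z_transformations_second_order_cone_iff)
    \<comment> \<open>One of \<open>x\<close> and \<open>- x\<close> has a nonnegative first coordinate, and the forms do not see the sign.\<close>
    have "x \<in> frontier second_order_cone \<or> - x \<in> frontier second_order_cone"
      using x by (auto simp: mem_frontier_second_order_cone_iff inner_J_mat)
    then show ?thesis
      using front [of x] front [of "- x"] by (auto simp: vec.neg)
  qed
  obtain u v :: "(real, 'n) vec" where "0 < u \<bullet> (J_mat *v u)" "v \<bullet> (J_mat *v v) < 0"
    using J_mat_indefinite [OF n] .
  with null obtain \<gamma> where \<gamma>: "\<And>x. 0 \<le> x \<bullet> ((S + \<gamma> *\<^sub>R J_mat) *v x)"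
    using finsler_lemma [of J_mat S] by blast
  show thesis
  proof
    have "transpose (S + \<gamma> *\<^sub>R J_mat) = S + \<gamma> *\<^sub>R J_mat"
      using S_sym transpose_J_mat [where 'n = 'n] by (simp add: transpose_def vec_eq_iff)
    with \<gamma> show "S + \<gamma> *\<^sub>R J_mat \<in> copositive_cone UNIV"
      by (simp add: copositive_cone_def symmetric_matrices_def)
    show "Q \<in> skew_symmetric_matrices"
      by (rule Q)
    have "S + \<gamma> *\<^sub>R J_mat + Q = \<gamma> *\<^sub>R J_mat + (S + Q)"
      by (simp add: add_ac)
    also have "\<dots> = \<gamma> *\<^sub>R J_mat - J_mat ** A"
      by (simp add: SQ B_def)
    finally have "J_mat ** (S + \<gamma> *\<^sub>R J_mat + Q) = J_mat ** (\<gamma> *\<^sub>R J_mat - J_mat ** A)"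
      by (rule arg_cong)
    also have "\<dots> = \<gamma> *\<^sub>R mat 1 - A"
      unfolding matrix_eq
      by (simp add: matrix_vector_mul_assoc [symmetric] matrix_vector_mult_diff_distrib
          matrix_vector_mult_diff_rdistrib scaleR_matrix_vector_assoc [symmetric]
          matrix_vector_mult_scaleR J_mat_mult_J_mat_mult)
    finally show "A = \<gamma> *\<^sub>R mat 1 - J_mat ** (S + \<gamma> *\<^sub>R J_mat + Q)"
      by simp
  qed
qed

theorem theorem3p1:
  fixes C :: "(real^'n::{finite,linorder}) set"
  assumes "CARD('n) > 1"
    and "C = UNIV \<or> C = second_order_cone \<or> C = frontier second_order_cone"
  shows "Z_transformations (second_order_cone :: (real^'n::{finite,linorder}) set) =
    {\<gamma> *\<^sub>R mat 1 - J_mat ** (P + Q) | \<gamma> P Q.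
       P \<in> copositive_cone C \<and> Q \<in> skew_symmetric_matrices}"
proof -
  \<comment> \<open>All three cones lie between the boundary, where copositivity suffices for the one inclusion, and
    the whole space, where the other inclusion provides it.\<close>
  have "frontier second_order_cone \<subseteq> C"
    using assms(2) frontier_second_order_cone_subset by blast
  then have C: "copositive_cone UNIV \<subseteq> copositive_cone C"
    "copositive_cone C \<subseteq> copositive_cone (frontier second_order_cone)"
    by (simp_all add: copositive_cone_antimono)
  show ?thesis
  proof (intro equalityI subsetI)
    fix A :: "((real, 'n) vec, 'n) vec"
    assume "A \<in> Z_transformations second_order_cone"
    then obtain \<gamma> P Q where "P \<in> copositive_cone UNIV" "Q \<in> skew_symmetric_matrices"
      "A = \<gamma> *\<^sub>R mat 1 - J_mat ** (P + Q)"
      by (rule Z_transformation_imp_semidefinite [OF assms(1)])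
    moreover from this C(1) have "P \<in> copositive_cone C"
      by (simp add: subsetD)
    ultimately show "A \<in> {\<gamma> *\<^sub>R mat 1 - J_mat ** (P + Q) | \<gamma> P Q.
        P \<in> copositive_cone C \<and> Q \<in> skew_symmetric_matrices}"
      by (intro CollectI exI conjI)
  next
    fix A :: "((real, 'n) vec, 'n) vec"
    assume "A \<in> {\<gamma> *\<^sub>R mat 1 - J_mat ** (P + Q) | \<gamma> P Q.
        P \<in> copositive_cone C \<and> Q \<in> skew_symmetric_matrices}"
    then obtain \<gamma> P Q where P: "P \<in> copositive_cone C" and Q: "Q \<in> skew_symmetric_matrices"
      and A: "A = \<gamma> *\<^sub>R mat 1 - J_mat ** (P + Q)"
      by (elim CollectE exE conjE)
    from P C(2) have "P \<in> copositive_cone (frontier second_order_cone)"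
      by (simp add: subsetD)
    then show "A \<in> Z_transformations second_order_cone"
      unfolding A using Q by (rule copositive_imp_Z_transformation)
  qed
qed

end
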